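(* Let $M\in\mathbb{R}^{m\times n}$ with $m\le n$. If $M$ has two rows with disjoint supports, then $M$ does not have the strong inner product property.
   Context: All matrices are real; $\circ$ denotes the Hadamard product. The support of a vector is the set of indices of its nonzero entries. A matrix $M\in\mathbb{R}^{m\times n}$ with $m\le n$ has the strong inner product property (SIPP) if $M$ has rank $m$ and $X=O$ is the only symmetric $m\times m$ matrix $X$ with $(XM)\circ M=O$. *)

theory Defs
  imports "HOL-Analysis.Analysis"
begin

definition vec_support :: "real ^ 'n \<Rightarrow> 'n set" where
  "vec_support v = {k. v $ k \<noteq> 0}"

definition hadamard_prod :: "real ^ 'n ^ 'm \<Rightarrow> real ^ 'n ^ 'm \<Rightarrow> real ^ 'n ^ 'm"
    (infixl \<open>\<circ>\<^sub>H\<close> 70) where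
  "A \<circ>\<^sub>H B = (\<chi> i j. A $ i $ j * B $ i $ j)"

definition symmetric_matrix :: "real ^ 'm ^ 'm \<Rightarrow> bool" where
  "symmetric_matrix X \<longleftrightarrow> transpose X = X"

text \<open>The type \<open>real ^ 'n ^ 'm\<close> consists of matrices with \<open>m = CARD('m)\<close> rows and \<open>n = CARD('n)\<close>
  columns. The property is meant for \<open>m \<le> n\<close>; for \<open>m > n\<close> it fails because of the rank condition.\<close>

definition SIPP :: "real ^ 'n ^ 'm \<Rightarrow> bool" where
  "SIPP M \<longleftrightarrow>
     rank M = CARD('m) \<and>
     (\<forall>X :: real ^ 'm ^ 'm. symmetric_matrix X \<and> (X ** M) \<circ>\<^sub>H M = 0 \<longrightarrow> X = 0)"

end

theory Submission
  imports Defs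
begin

text \<open>The symmetric matrix \<open>X\<close> = E_ij + E_ji, where \<open>i\<close> and
  \<open>j\<close> index the two given rows, violates the uniqueness clause of \<open>SIPP\<close>.
  Multiplying \<open>M\<close> by it on the left swaps rows \<open>i\<close> and \<open>j\<close>
  and replaces every other row by zero. In the Hadamard product with \<open>M\<close>, rows
  \<open>i\<close> and \<open>j\<close> therefore both become the entrywise product of these two
  rows, which vanishes because their supports are disjoint. Yet \<open>X\<close> is nonzero.\<close>

theorem lemma3p6:
  fixes M :: "real ^ 'n ^ 'm"
  assumes "CARD('m) \<le> CARD('n)"
    and "\<exists>i j. i \<noteq> j \<and> vec_support (row i M) \<inter> vec_support (row j M) = {}"
  shows "\<not> SIPP M"
proof
  assume sipp: "SIPP M"
  obtain i j where ij: "i \<noteq> j" and disj: "vec_support (row i M) \<inter> vec_support (row j M) = {}"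
    using assms(2) by blast
  have zero: "M $ i $ k * M $ j $ k = 0" for k
    using disj by (auto simp: vec_support_def row_def)
  define X :: "real ^ 'm ^ 'm"
    where "X = (\<chi> a b. if (a = i \<and> b = j) \<or> (a = j \<and> b = i) then 1 else 0)"
  have "symmetric_matrix X"
    unfolding symmetric_matrix_def vec_eq_iff by (simp add: X_def transpose_def conj_commute disj_commute)
  moreover have "(X ** M) $ a $ k = (if a = i then M $ j $ k else 0) + (if a = j then M $ i $ k else 0)" for a k
  proof -
    \<comment> \<open>As \<open>i\<close> and \<open>j\<close> differ, the two cases in the
      definition of \<open>X\<close> exclude each other, so its disjunction can be split into a sum.
      Each half is then a delta in \<open>b\<close>, which \<open>sum.delta\<close>
      collapses.\<close>
    have "(X ** M) $ a $ k =
        (\<Sum>b\<in>UNIV. (if b = j then (if a = i then M $ b $ k else 0) else 0)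
               + (if b = i then (if a = j then M $ b $ k else 0) else 0))"
      unfolding X_def matrix_matrix_mult_def using ij by (simp, intro sum.cong) auto
    then show ?thesis
      by (simp only: sum.distrib sum.delta finite UNIV_I if_True)
  qed
  then have "(X ** M) \<circ>\<^sub>H M = 0"
    using zero ij by (auto simp: hadamard_prod_def vec_eq_iff mult.commute)
  ultimately have "X = 0"
    using sipp by (simp add: SIPP_def)
  moreover have "X $ i $ j = 1"
    using ij by (simp add: X_def)
  ultimately show False
    by simp
qed

end
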